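(* Let $p>3$ be a prime. Then $$\sum_{k=0}^{(p-1)/2}\frac{3k+1}{16^k}\binom{2k}{k}^3\equiv p+2\left(\frac{-1}{p}\right)p^3E_{p-3}\pmod{p^4}.$$
   Context: $\left(\frac{-1}{p}\right)=(-1)^{(p-1)/2}$ is the Legendre symbol. $E_0,E_1,E_2,\dots$ are the Euler numbers, defined by $\frac{2}{e^t+e^{-t}}=\sum_{n\ge0}E_n\frac{t^n}{n!}$. A congruence between rational numbers modulo $p^4$ means that their difference is a rational number whose numerator (in lowest terms) is divisible by $p^4$ and whose denominator is coprime to $p$. *)

theory Defs
  imports
    "HOL-Number_Theory.Number_Theory"
    "HOL-Computational_Algebra.Formal_Power_Series"
begin

definition euler_number :: "nat \<Rightarrow> rat" where
  "euler_number n = fact n * fps_nth (2 / (fps_exp 1 + fps_exp (-1))) n"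

text \<open>
  \<open>rat_cong p r a b\<close> is \<open>a \<equiv> b (mod p\<^sup>r)\<close>. Recall that \<open>quotient_of\<close> yields
  the numerator and the (positive) denominator in lowest terms.
\<close>
definition rat_cong :: "nat \<Rightarrow> nat \<Rightarrow> rat \<Rightarrow> rat \<Rightarrow> bool" where
  "rat_cong p r a b \<longleftrightarrow>
     int (p ^ r) dvd fst (quotient_of (a - b)) \<and> coprime (snd (quotient_of (a - b))) (int p)"

end

theory Submission
  imports Defs "HOL-Computational_Algebra.Polynomial"
begin

text \<open>
  Put \<open>t\<^sub>n(y) = \<Prod>j=1..n. (2j-1)((2j-1)\<^sup>2-y\<^sup>2) / (2j(j\<^sup>2-y\<^sup>2))\<close>, so that
  \<open>t\<^sub>n(0) = binom(2n,n)\<^sup>3 / 16\<^sup>n\<close>. For odd \<open>y\<close> the sum of \<open>(3n+1) t\<^sub>n(y)\<close> terminates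
  and equals \<open>y\<close>. Multiplied by \<open>\<Prod>j=1..N. j\<^sup>2-y\<^sup>2\<close>, the sum truncated at \<open>N\<close> is a
  polynomial of degree at most \<open>N\<close> in \<open>y\<^sup>2\<close> that is therefore known at the \<open>N+1\<close> squares of
  \<open>1, 3, \<dots>, 2N+1\<close>. Lagrange interpolation at \<open>y = 0\<close> gives, with \<open>p = 2N+1\<close> and
  \<open>E\<^sub>r(x) = \<Prod>s=1..r. 1+x/s\<close>, the exact value
  \<open>p E\<^sub>N(-p/2)\<^sup>2 (E\<^sub>N(p) + p\<^sup>2 (\<Sum>i=1..N div 2. E\<^bsub>N-2i\<^esub>(p) E\<^bsub>i-1\<^esub>(-p) / (i(2i-p))))\<close>
  of the sum in question. For a prime \<open>p > 3\<close> the product \<open>E\<^sub>N(-p/2)\<^sup>2 E\<^sub>N(p)\<close> is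
  \<open>1 - (3/4) p\<^sup>2 (\<Sum>j=1..N. 1/j\<^sup>2)\<close> modulo \<open>p\<^sup>3\<close>, hence \<open>1\<close>, and the remaining sum is
  \<open>(1/2) (\<Sum>i=1..N div 2. 1/i\<^sup>2)\<close> modulo \<open>p\<close>. The latter is turned into an Euler number by
  comparing coefficients in
  \<open>(e\<^sup>t + e\<^sup>-\<^sup>t) (\<Sum>j=-N..N. (-1)\<^sup>j e\<^bsup>2jt\<^esup>) = (-1)\<^sup>N (e\<^bsup>pt\<^esup> + e\<^bsup>-pt\<^esup>)\<close>.
\<close>

section \<open>A terminating sum\<close>

definition wp_term :: "nat \<Rightarrow> rat \<Rightarrow> rat" where
  "wp_term n y = (\<Prod>j = 1..n. of_nat (2 * j - 1) * (of_nat (2 * j - 1) ^ 2 - y ^ 2)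
                               / (of_nat (2 * j) * (of_nat j ^ 2 - y ^ 2)))"

lemma wp_term_0 [simp]: "wp_term 0 y = 1"
  by (simp add: wp_term_def)

lemma wp_term_Suc:
  "wp_term (Suc n) y = wp_term n y * ((2 * of_nat n + 1) * ((2 * of_nat n + 1 - y) * (2 * of_nat n + 1 + y))
     / (2 * (of_nat n + 1) * ((of_nat n + 1 - y) * (of_nat n + 1 + y))))"
  by (simp add: wp_term_def power2_eq_square algebra_simps)

text \<open>Raising \<open>y\<close> by 2 shifts each of the linear factors \<open>2j-1-y\<close>,
  \<open>2j-1+y\<close>, \<open>j-y\<close>, \<open>j+y\<close> along its own progression, so the
  quotient of the two products telescopes to a rational function. The hypothesis keeps
  \<open>y\<close> above \<open>2n-1\<close>, away from the poles and zeros involved.\<close>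

lemma wp_term_shift:
  fixes y :: rat
  assumes "2 * of_nat n < y + 1"
  shows "wp_term n (y + 2) * (y * (y + 1 - 2 * of_nat n) * (y + 1 + of_nat n) * (y + 2 + of_nat n))
       = wp_term n y * ((y + 2) * (y + 1 + 2 * of_nat n) * (y - of_nat n) * (y + 1 - of_nat n))"
  using assms
proof (induction n)
  case 0
  then show ?case by (simp add: algebra_simps)
next
  case (Suc n)
  define m :: rat where "m = of_nat n"
  have m0: "m \<ge> 0" and ym: "y > 2 * m + 1"
    using Suc.prems by (simp_all add: m_def)
  have nz: "m + 1 \<noteq> 0" "m + 1 - y \<noteq> 0" "m + 1 + y \<noteq> 0" "m + 1 - (y + 2) \<noteq> 0"
    "m + 1 + (y + 2) \<noteq> 0" "y + 1 - 2 * m \<noteq> 0" "y + 2 + m \<noteq> 0" "y - m \<noteq> 0"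
    using m0 ym by linarith+
  have IH: "wp_term n (y + 2) * (y * (y + 1 - 2 * m) * (y + 1 + m) * (y + 2 + m))
       = wp_term n y * ((y + 2) * (y + 1 + 2 * m) * (y - m) * (y + 1 - m))"
    using Suc by (simp add: m_def)
  define c where "c = (2 * m + 1) / (2 * (m + 1))"
  have S: "wp_term (Suc n) y = wp_term n y * c * ((2 * m + 1 - y) * (2 * m + 1 + y) / ((m + 1 - y) * (m + 1 + y)))"
    "wp_term (Suc n) (y + 2) = wp_term n (y + 2) * c
       * ((2 * m + 1 - (y + 2)) * (2 * m + 1 + (y + 2)) / ((m + 1 - (y + 2)) * (m + 1 + (y + 2))))"
    by (simp_all add: wp_term_Suc m_def c_def)
  have "wp_term (Suc n) (y + 2) * (y * (y - 1 - 2 * m) * (y + 2 + m) * (y + 3 + m))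
     = c * (wp_term n (y + 2) * (y * (y + 1 - 2 * m) * (y + 1 + m) * (y + 2 + m)))
         * ((2 * m + 3 + y) * (y - 1 - 2 * m) / ((y + 1 - m) * (y + 1 + m)))"
    unfolding S using nz by (simp add: divide_simps) (simp add: algebra_simps)
  also have "\<dots> = wp_term (Suc n) y * ((y + 2) * (y + 3 + 2 * m) * (y - 1 - m) * (y - m))"
    unfolding IH S using nz by (simp add: divide_simps) (simp add: algebra_simps)
  finally show ?case
    by (simp add: m_def algebra_simps)
qed

text \<open>
  Wilf--Zeilberger pair: \<open>F n y = (3 n + 1) wp_term n y / y\<close> and
  \<open>G n y = 4 n\<^sup>2 (n - y) / ((3 n + 1) (y + 1 - 2 n) (y + 1 + n)) F n y\<close> satisfy
  \<open>F n (y + 2) - F n y = G (n + 1) y - G n y\<close>. The right-hand side below is \<open>G (n + 1) y\<close>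
  expressed through \<open>wp_term n y\<close>, so that it makes sense also for \<open>y = 2 n + 1\<close>, where
  \<open>G (n + 1) y\<close> has the form \<open>0 / 0\<close>.
\<close>
lemma wp_term_telescope:
  fixes y :: rat
  assumes "2 * of_nat n < y + 1" and "y > 0"
  shows "(\<Sum>m\<le>n. (3 * of_nat m + 1) * (wp_term m (y + 2) / (y + 2) - wp_term m y / y))
       = - 2 * (of_nat n + 1) * (2 * of_nat n + 1) * (2 * of_nat n + 1 + y) * wp_term n y
         / (y * (of_nat n + 1 + y) * (of_nat n + 2 + y))"
  using assms(1)
proof (induction n)
  case 0
  then show ?case using \<open>y > 0\<close> by (simp add: divide_simps) (simp add: algebra_simps)
next
  case (Suc n)
  define m :: rat where "m = of_nat n"
  have m0: "m \<ge> 0" and ym: "y > 2 * m + 1"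
    using Suc.prems by (simp_all add: m_def)
  have nz: "m + 1 \<noteq> 0" "m + 1 - y \<noteq> 0" "m + 1 + y \<noteq> 0" "y \<noteq> 0" "y + 2 \<noteq> 0"
    "m + 2 + y \<noteq> 0" "m + 3 + y \<noteq> 0" "y - 1 - 2 * m \<noteq> 0"
    using m0 ym by linarith+
  define a where "a = wp_term n y"
  define b where "b = wp_term (Suc n) y"
  have b: "b = a * ((2 * m + 1) * ((2 * m + 1 - y) * (2 * m + 1 + y)) / (2 * (m + 1) * ((m + 1 - y) * (m + 1 + y))))"
    by (simp add: a_def b_def m_def wp_term_Suc)
  have "wp_term (Suc n) (y + 2) * (y * (y - 1 - 2 * m) * (m + 2 + y) * (m + 3 + y))
      = b * ((y + 2) * (y + 3 + 2 * m) * (y - 1 - m) * (y - m))"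
    using wp_term_shift[OF Suc.prems] by (simp add: b_def m_def algebra_simps)
  hence shift: "wp_term (Suc n) (y + 2) / (y + 2)
      = b * ((y + 3 + 2 * m) * (y - 1 - m) * (y - m)) / (y * (y - 1 - 2 * m) * (m + 2 + y) * (m + 3 + y))"
    using nz by (simp add: divide_simps mult_ac)
  have IH: "(\<Sum>m\<le>n. (3 * of_nat m + 1) * (wp_term m (y + 2) / (y + 2) - wp_term m y / y))
       = - 2 * (m + 1) * (2 * m + 1) * (2 * m + 1 + y) * a / (y * (m + 1 + y) * (m + 2 + y))"
    using Suc by (simp add: m_def a_def)
  \<comment> \<open>The induction hypothesis is \<open>- 2 * (m + 1) * c\<close>. Writing
    \<open>b\<close>, and through \<open>shift\<close> also the term at \<open>y + 2\<close>, as
    multiples of \<open>c\<close> leaves an identity of rational functions in \<open>m\<close> and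
    \<open>y\<close>.\<close>
  define c where "c = a * (2 * m + 1) * (2 * m + 1 + y) / (y * (m + 1 + y) * (m + 2 + y))"
  have b2: "b = - c * (y * (m + 2 + y) * (y - 1 - 2 * m)) / (2 * (m + 1) * (m + 1 - y))"
    using nz by (simp add: b c_def divide_simps) (simp add: algebra_simps)
  have "(\<Sum>m\<le>Suc n. (3 * of_nat m + 1) * (wp_term m (y + 2) / (y + 2) - wp_term m y / y))
      = - 2 * (m + 1) * c + (3 * m + 4) * (wp_term (Suc n) (y + 2) / (y + 2) - b / y)"
    unfolding sum.atMost_Suc IH by (simp add: m_def b_def c_def add_ac mult_ac)
  also have "\<dots> = - 2 * (m + 2) * (2 * m + 3) * (2 * m + 3 + y) * b / (y * (m + 2 + y) * (m + 3 + y))"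
    unfolding shift unfolding b2 using nz by (simp add: divide_simps) (simp add: algebra_simps)
  finally show ?case
    by (simp add: m_def b_def add_ac)
qed

text \<open>With \<open>y = 2M+1\<close>, \<open>wp_term_telescope\<close> compares the sums up to
  \<open>M\<close> at \<open>y\<close> and \<open>y + 2\<close>. The sum at \<open>y + 2\<close> has
  one further term, \<open>n = M+1\<close>, which cancels the boundary term, so sum divided by
  \<open>y\<close> stays 1.\<close>

lemma wp_sum: "(\<Sum>n\<le>M. (3 * of_nat n + 1) * wp_term n (2 * of_nat M + 1)) = 2 * of_nat M + 1"
proof (induction M)
  case 0
  then show ?case by simp
next
  case (Suc M)
  define m :: rat where "m = of_nat M"
  define y where "y = 2 * m + 1"
  have m0: "m \<ge> 0"
    by (simp add: m_def)
  have nz: "m + 1 \<noteq> 0" "3 * m + 2 \<noteq> 0" "2 * m + 3 \<noteq> 0" "2 * m + 1 \<noteq> 0" "3 * m + 4 \<noteq> 0" "m + 2 \<noteq> 0"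
    using m0 by linarith+
  have y0: "y \<noteq> 0" "y + 2 \<noteq> 0" "y > 0"
    using m0 by (simp_all add: y_def)
  define a where "a = wp_term M y"
  have tel: "(\<Sum>n\<le>M. (3 * of_nat n + 1) * (wp_term n (y + 2) / (y + 2) - wp_term n y / y))
       = - 2 * (m + 1) * (2 * m + 1) * (2 * m + 1 + y) * a / (y * (m + 1 + y) * (m + 2 + y))"
    using wp_term_telescope[of M y] y0 by (simp add: m_def a_def y_def)
  have "wp_term M (y + 2) * (y * (y + 1 - 2 * m) * (y + 1 + m) * (y + 2 + m))
       = a * ((y + 2) * (y + 1 + 2 * m) * (y - m) * (y + 1 - m))"
    using wp_term_shift[of M y] by (simp add: m_def y_def a_def)
  hence "2 * (2 * m + 1) * (m + 1) * (wp_term M (y + 2) * (3 * (3 * m + 2)))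
      = 2 * (2 * m + 1) * (m + 1) * (a * (2 * m + 3) * (m + 2))"
    by (simp add: y_def algebra_simps)
  hence "wp_term M (y + 2) * (3 * (3 * m + 2)) = a * (2 * m + 3) * (m + 2)"
    using nz by simp
  hence wM: "wp_term M (y + 2) = a * (2 * m + 3) * (m + 2) / (3 * (3 * m + 2))"
    using nz by (simp add: eq_divide_eq)
  have "(2 * m + 1) * ((2 * m + 1 - (y + 2)) * (2 * m + 1 + (y + 2))) / (2 * (m + 1) * ((m + 1 - (y + 2)) * (m + 1 + (y + 2))))
      = 4 * (2 * m + 1) / ((m + 2) * (3 * m + 4))"
    using nz by (simp add: y_def divide_simps) (simp add: algebra_simps)
  \<comment> \<open>\<open>wp_term_shift\<close> does not apply to \<open>Suc M\<close>, because
    \<open>y + 1\<close> equals \<open>2 * (m + 1)\<close>. The last term is therefore obtained from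
    \<open>wM\<close> by the recurrence in \<open>n\<close>.\<close>
  hence last: "wp_term (Suc M) (y + 2) = 4 * a * (2 * m + 3) * (2 * m + 1) / (3 * (3 * m + 2) * (3 * m + 4))"
    unfolding wp_term_Suc m_def[symmetric] wM using nz by simp
  have "(\<Sum>n\<le>M. (3 * of_nat n + 1) * (wp_term n (y + 2) / (y + 2) - wp_term n y / y))
      = (\<Sum>n\<le>M. (3 * of_nat n + 1) * wp_term n (y + 2)) / (y + 2) - (\<Sum>n\<le>M. (3 * of_nat n + 1) * wp_term n y) / y"
    by (simp add: sum_divide_distrib right_diff_distrib sum_subtractf)
  also have "(\<Sum>n\<le>M. (3 * of_nat n + 1) * wp_term n y) / y = 1"
    using Suc y0 by (simp add: y_def m_def)
  finally have sumM: "(\<Sum>n\<le>M. (3 * of_nat n + 1) * wp_term n (y + 2)) / (y + 2) =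
      1 + - 2 * (m + 1) * (2 * m + 1) * (2 * m + 1 + y) * a / (y * (m + 1 + y) * (m + 2 + y))"
    using tel by simp
  have "- 2 * (m + 1) * (2 * m + 1) * (2 * m + 1 + y) * a / (y * (m + 1 + y) * (m + 2 + y))
      + (3 * m + 4) * wp_term (Suc M) (y + 2) / (y + 2) = 0"
    unfolding last using nz by (simp add: y_def divide_simps) (simp add: algebra_simps)
  hence "(\<Sum>n\<le>Suc M. (3 * of_nat n + 1) * wp_term n (y + 2)) / (y + 2) = 1"
    unfolding sum.atMost_Suc add_divide_distrib sumM by (simp add: m_def add_ac)
  hence "(\<Sum>n\<le>Suc M. (3 * of_nat n + 1) * wp_term n (y + 2)) = y + 2"
    using y0 by (simp add: divide_eq_eq)
  thus ?case
    by (simp add: y_def m_def add_ac)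
qed

section \<open>Interpolation\<close>

lemma lagrange_interpolation:
  fixes P :: "'a :: field poly"
  assumes "finite A" and "degree P < card A"
  shows "poly P x = (\<Sum>a\<in>A. poly P a * (\<Prod>b\<in>A - {a}. (x - b) / (a - b)))"
proof -
  define L where "L a = (\<Prod>b\<in>A - {a}. smult (inverse (a - b)) [:- b, 1:])" for a
  define Q where "Q = (\<Sum>a\<in>A. smult (poly P a) (L a))"
  have poly_L: "poly (L a) x = (\<Prod>b\<in>A - {a}. (x - b) / (a - b))" for a x
    unfolding L_def poly_prod by (intro prod.cong refl) (simp add: divide_inverse algebra_simps)
  have poly_Q: "poly Q x = (\<Sum>a\<in>A. poly P a * (\<Prod>b\<in>A - {a}. (x - b) / (a - b)))" for x
    by (simp add: Q_def poly_sum poly_L)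
  have deg_L: "degree (L a) < card A" if "a \<in> A" for a
  proof -
    have "degree (L a) \<le> (\<Sum>b\<in>A - {a}. degree (smult (inverse (a - b)) [:- b, 1:]))"
      using degree_prod_sum_le[of "A - {a}" "\<lambda>b. smult (inverse (a - b)) [:- b, 1:]"] assms(1)
      by (simp add: L_def o_def)
    also have "\<dots> \<le> (\<Sum>b\<in>A - {a}. 1)"
      by (intro sum_mono) simp
    also have "\<dots> < card A"
      using card_Diff1_less[OF assms(1) that] by simp
    finally show ?thesis .
  qed
  have "degree Q < card A"
    unfolding Q_def using assms(2) by (intro degree_sum_less le_less_trans[OF degree_smult_le deg_L]) auto
  moreover have "poly Q c = poly P c" if "c \<in> A" for c
  proof -
    have "(\<Prod>b\<in>A - {a}. (c - b) / (a - b)) = (if a = c then 1 else 0)" if "a \<in> A" for a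
      using \<open>c \<in> A\<close> assms(1) by (cases "a = c") auto
    hence "poly Q c = (\<Sum>a\<in>A. if a = c then poly P a else 0)"
      unfolding poly_Q by (intro sum.cong) auto
    thus ?thesis
      using that assms(1) by (simp add: sum.delta)
  qed
  ultimately have "Q = P"
    using assms(2) by (intro poly_eqI_degree[of A]) auto
  show ?thesis
    using poly_Q[of x] unfolding \<open>Q = P\<close> .
qed

lemma wp_term_zero: "wp_term n 0 = of_nat (2 * n choose n) ^ 3 / 16 ^ n"
proof (induction n)
  case (Suc n)
  have central: "of_nat (2 * k choose k) = (fact (2 * k) / (fact k * fact k) :: rat)" for k
    using binomial_fact[of k "2 * k", where 'a = rat] by (simp add: mult_2)
  have "of_nat (2 * Suc n choose Suc n) = (2 * (2 * of_nat n + 1) * of_nat (2 * n choose n) / (of_nat n + 1) :: rat)"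
    unfolding central by (simp add: divide_simps) (simp add: algebra_simps)
  moreover have "(2 * u * v / w) ^ 3 / (16 * z) = v ^ 3 / z * (u ^ 3 / (2 * w ^ 3))" for u v w z :: rat
    by (simp add: power_divide power_mult_distrib mult_ac)
  ultimately have "of_nat (2 * Suc n choose Suc n) ^ 3 / 16 ^ Suc n =
      of_nat (2 * n choose n) ^ 3 / 16 ^ n * ((2 * of_nat n + 1) ^ 3 / (2 * (of_nat n + 1 :: rat) ^ 3))"
    by (metis power_Suc)
  moreover have "wp_term (Suc n) 0 = wp_term n 0 * ((2 * of_nat n + 1) ^ 3 / (2 * (of_nat n + 1) ^ 3))"
    by (simp only: wp_term_Suc power3_eq_cube diff_0_right add_0_right mult.assoc)
  ultimately show ?case
    by (simp only: Suc)
qed simp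

text \<open>The numerator factor for \<open>j = m + 1\<close> vanishes; this is what makes the sum
  terminate at odd arguments.\<close>

lemma wp_term_eq_0: "wp_term n (2 * of_nat m + 1) = 0" if "m < n"
  unfolding wp_term_def
proof (rule prod_zero)
  show "\<exists>j\<in>{1..n}. of_nat (2 * j - 1) * (of_nat (2 * j - 1) ^ 2 - (2 * of_nat m + 1) ^ 2)
      / (of_nat (2 * j) * (of_nat j ^ 2 - (2 * of_nat m + 1 :: rat) ^ 2)) = 0"
    using that by (intro bexI[of _ "m + 1"]) auto
qed simp

text \<open>
  The truncated sum \<open>\<Sum>n\<le>N. (3 n + 1) wp_term n y\<close> with the denominators \<open>j\<^sup>2 - y\<^sup>2\<close>
  cleared, as a polynomial in \<open>y\<^sup>2\<close>.
\<close>
definition wp_poly :: "nat \<Rightarrow> rat poly" where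
  "wp_poly N = (\<Sum>n\<le>N. smult ((3 * of_nat n + 1) * (\<Prod>j = 1..n. of_nat (2 * j - 1) / of_nat (2 * j)))
     ((\<Prod>j = 1..n. [:of_nat (2 * j - 1) ^ 2, -1:]) * (\<Prod>j = n + 1..N. [:of_nat j ^ 2, -1:])))"

text \<open>The summand of index \<open>n\<close> is a product of \<open>n + (N - n)\<close> linear
  factors.\<close>

lemma degree_wp_poly: "degree (wp_poly N) \<le> N"
proof -
  have deg: "degree (\<Prod>j\<in>J. [:f j, -1:]) \<le> card J" if "finite J" for J :: "nat set" and f :: "nat \<Rightarrow> rat"
    using degree_prod_sum_le[OF that, of "\<lambda>j. [:f j, -1:]"] by (simp add: o_def)
  have le: "degree (smult c ((\<Prod>j = 1..n. [:of_nat (2 * j - 1) ^ 2, -1:]) * (\<Prod>j = n + 1..N. [:of_nat j ^ 2, -1:])))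
      \<le> n + (N - n)" for n and c :: rat
    by (rule order_trans[OF degree_smult_le], rule order_trans[OF degree_mult_le], rule add_mono)
      (use deg[of "{1..n}" "\<lambda>j. of_nat (2 * j - 1) ^ 2"] deg[of "{n + 1..N}" "\<lambda>j. of_nat j ^ 2"] in simp_all)
  have bound: "degree (smult c ((\<Prod>j = 1..n. [:of_nat (2 * j - 1) ^ 2, -1:]) * (\<Prod>j = n + 1..N. [:of_nat j ^ 2, -1:])))
      \<le> N" if "n \<in> {..N}" for n and c :: rat
    using le[of c n] that by (simp only: le_add_diff_inverse atMost_iff)
  show ?thesis
    unfolding wp_poly_def by (intro degree_sum_le bound) simp_all
qed

lemma poly_wp_poly:
  assumes "\<And>j. j \<in> {1..N} \<Longrightarrow> of_nat j ^ 2 \<noteq> y ^ 2"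
  shows "poly (wp_poly N) (y ^ 2) = (\<Prod>j = 1..N. of_nat j ^ 2 - y ^ 2) * (\<Sum>n\<le>N. (3 * of_nat n + 1) * wp_term n y)"
  unfolding wp_poly_def poly_sum sum_distrib_left
proof (rule sum.cong)
  fix n assume n: "n \<in> {..N}"
  have "(\<Prod>j = 1..N. of_nat j ^ 2 - y ^ 2) = (\<Prod>j = 1..n. of_nat j ^ 2 - y ^ 2) * (\<Prod>j = n + 1..N. of_nat j ^ 2 - y ^ 2)"
    using prod.ub_add_nat[of 1 n "\<lambda>j. of_nat j ^ 2 - y ^ 2" "N - n"] n by simp
  moreover have "(\<Prod>j = 1..n. of_nat j ^ 2 - y ^ 2) \<noteq> 0"
    using assms n by auto
  ultimately show "poly (smult ((3 * of_nat n + 1) * (\<Prod>j = 1..n. of_nat (2 * j - 1) / of_nat (2 * j)))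
     ((\<Prod>j = 1..n. [:of_nat (2 * j - 1) ^ 2, -1:]) * (\<Prod>j = n + 1..N. [:of_nat j ^ 2, -1:]))) (y ^ 2)
     = (\<Prod>j = 1..N. of_nat j ^ 2 - y ^ 2) * ((3 * of_nat n + 1) * wp_term n y)"
    by (simp add: wp_term_def poly_prod prod_dividef prod.distrib)
qed simp

text \<open>
  For odd \<open>y \<le> N\<close> both sides vanish although the sum itself has a pole, so the \<open>N + 1\<close> squares of
  \<open>1, 3, \<dots>, 2 N + 1\<close> are interpolation nodes.
\<close>
lemma poly_wp_poly_odd:
  assumes "m \<le> N"
  shows "poly (wp_poly N) ((2 * of_nat m + 1) ^ 2)
       = (2 * of_nat m + 1) * (\<Prod>j = 1..N. of_nat j ^ 2 - (2 * of_nat m + 1) ^ 2)"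
proof (cases "N < 2 * m + 1")
  case True
  have "of_nat j ^ 2 \<noteq> (2 * of_nat m + 1 :: rat) ^ 2" if "j \<in> {1..N}" for j
  proof -
    have "j \<noteq> 2 * m + 1"
      using that True by auto
    hence "of_nat j \<noteq> (of_nat (2 * m + 1) :: rat)"
      by (simp only: of_nat_eq_iff not_False_eq_True)
    thus ?thesis
      by (simp add: power2_eq_iff_nonneg)
  qed
  moreover have "(\<Sum>n\<le>N. (3 * of_nat n + 1) * wp_term n (2 * of_nat m + 1)) =
      (\<Sum>n\<le>m. (3 * of_nat n + 1) * wp_term n (2 * of_nat m + 1))"
    using assms by (intro sum.mono_neutral_right) (auto simp: wp_term_eq_0)
  ultimately show ?thesis
    by (subst poly_wp_poly) (simp_all add: wp_sum)
next
  case False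
  \<comment> \<open>Every summand has a root here: for \<open>n < 2m+1\<close> the second product
    contains \<open>j = 2m+1\<close>, and otherwise the first product contains
    \<open>j = m+1\<close>.\<close>
  have factor: "poly (smult c ((\<Prod>j = 1..n. [:of_nat (2 * j - 1) ^ 2, -1:]) * (\<Prod>j = n + 1..N. [:of_nat j ^ 2, -1:])))
      ((2 * of_nat m + 1) ^ 2) = 0" if "n \<le> N" for n and c :: rat
  proof (cases "n < 2 * m + 1")
    case True
    have "(\<Prod>j = n + 1..N. of_nat j ^ 2 - (2 * of_nat m + 1 :: rat) ^ 2) = 0"
      using True False by (intro prod_zero bexI[of _ "2 * m + 1"]) auto
    thus ?thesis by (simp add: poly_prod)
  next
    case False
    have "(\<Prod>j = 1..n. of_nat (2 * j - 1) ^ 2 - (2 * of_nat m + 1 :: rat) ^ 2) = 0"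
      using False by (intro prod_zero bexI[of _ "m + 1"]) auto
    thus ?thesis by (simp add: poly_prod)
  qed
  have "(\<Prod>j = 1..N. of_nat j ^ 2 - (2 * of_nat m + 1 :: rat) ^ 2) = 0"
    using False by (intro prod_zero bexI[of _ "2 * m + 1"]) auto
  moreover have "poly (wp_poly N) ((2 * of_nat m + 1) ^ 2) = 0"
    unfolding wp_poly_def poly_sum by (intro sum.neutral ballI factor) simp
  ultimately show ?thesis
    by simp
qed

text \<open>The factors \<open>(j-y)(j+y)\<close> yield, up to sign, all integers from
  \<open>y-N\<close> to \<open>y+N\<close> except \<open>y\<close> itself.\<close>

lemma prod_squares_diff:
  assumes "N < y"
  shows "(\<Prod>j = 1..N. of_nat j ^ 2 - of_nat y ^ 2) * (of_nat y * fact (y - N - 1)) = ((-1) ^ N * fact (y + N) :: rat)"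
  using assms
proof (induction N)
  case 0
  then show ?case by (simp add: fact_reduce)
next
  case (Suc N)
  have "fact (y - N - 1) = (of_nat (y - Suc N) * fact (y - Suc N - 1) :: rat)"
    using Suc.prems fact_reduce[of "y - Suc N", where 'a = rat] by simp
  moreover have "of_nat (y - Suc N) = (of_nat y - of_nat (Suc N) :: rat)"
    using Suc.prems by (simp add: of_nat_diff)
  ultimately have IH: "(\<Prod>j = 1..N. of_nat j ^ 2 - of_nat y ^ 2) * (of_nat y * ((of_nat y - of_nat (Suc N)) * fact (y - Suc N - 1)))
      = ((-1) ^ N * fact (y + N) :: rat)"
    using Suc by simp
  have "(\<Prod>j = 1..Suc N. of_nat j ^ 2 - of_nat y ^ 2) * (of_nat y * fact (y - Suc N - 1)) =
     - (of_nat y + of_nat (Suc N)) * ((\<Prod>j = 1..N. of_nat j ^ 2 - of_nat y ^ 2)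
        * (of_nat y * ((of_nat y - of_nat (Suc N)) * fact (y - Suc N - 1))) :: rat)"
    by (simp add: power2_eq_square algebra_simps)
  also have "\<dots> = (-1) ^ Suc N * fact (y + Suc N)"
    unfolding IH by (simp add: algebra_simps)
  finally show ?case .
qed

text \<open>Each factor is \<open>4(l-m)(l+m+1)\<close>. The differences \<open>l-m\<close> give
  \<open>(-1)^m m! (N-m)!\<close>, and the sums \<open>l+m+1\<close> give \<open>(N+m+1)!\<close>
  without \<open>m!\<close> and without the omitted factor \<open>2m+1\<close>.\<close>

lemma prod_odd_squares_diff:
  assumes "m \<le> N"
  shows "(\<Prod>l\<in>{..N} - {m}. (2 * of_nat l + 1) ^ 2 - (2 * of_nat m + 1) ^ 2) * (2 * of_nat m + 1)
       = (4 ^ N * (-1) ^ m * fact (N - m) * fact (N + m + 1) :: rat)"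
  using assms
proof (induction N rule: dec_induct)
  case base
  \<comment> \<open>The outer induction starts at \<open>N = m\<close>, where only
    \<open>l < m\<close> remain; this product is built up factor by factor.\<close>
  have "(\<Prod>l<k. (2 * of_nat l + 1) ^ 2 - (2 * of_nat m + 1) ^ 2) * (fact (m - k) * fact m)
      = (4 ^ k * (-1) ^ k * fact m * fact (m + k) :: rat)" if "k \<le> m" for k
    using that
  proof (induction k)
    case (Suc k)
    have f: "fact (m - k) = ((of_nat m - of_nat k) * fact (m - Suc k) :: rat)"
      using Suc.prems fact_reduce[of "m - k", where 'a = rat] by (simp add: of_nat_diff)
    have IH: "(\<Prod>l<k. (2 * of_nat l + 1) ^ 2 - (2 * of_nat m + 1) ^ 2) * ((of_nat m - of_nat k) * fact (m - Suc k) * fact m)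
      = (4 ^ k * (-1) ^ k * fact m * fact (m + k) :: rat)"
      using Suc by (simp add: f)
    have "(\<Prod>l<Suc k. (2 * of_nat l + 1) ^ 2 - (2 * of_nat m + 1) ^ 2) * (fact (m - Suc k) * fact m)
       = - 4 * (of_nat m + of_nat k + 1) * ((\<Prod>l<k. (2 * of_nat l + 1) ^ 2 - (2 * of_nat m + 1) ^ 2)
           * ((of_nat m - of_nat k) * fact (m - Suc k) * fact m) :: rat)"
      by (simp add: power2_eq_square algebra_simps)
    also have "\<dots> = 4 ^ Suc k * (-1) ^ Suc k * fact m * fact (m + Suc k)"
      unfolding IH by (simp add: algebra_simps)
    finally show ?case .
  qed simp
  from this[of m] have "(\<Prod>l<m. (2 * of_nat l + 1) ^ 2 - (2 * of_nat m + 1) ^ 2) = (4 ^ m * (-1) ^ m * fact (m + m) :: rat)"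
    by simp
  moreover have "{..m} - {m} = {..<m}"
    by auto
  ultimately show ?case
    by (simp add: algebra_simps)
next
  case (step N)
  have "{..Suc N} - {m} = insert (Suc N) ({..N} - {m})"
    using step by auto
  hence "(\<Prod>l\<in>{..Suc N} - {m}. (2 * of_nat l + 1) ^ 2 - (2 * of_nat m + 1) ^ 2) * (2 * of_nat m + 1)
     = ((2 * of_nat N + 3) ^ 2 - (2 * of_nat m + 1) ^ 2) *
       ((\<Prod>l\<in>{..N} - {m}. (2 * of_nat l + 1) ^ 2 - (2 * of_nat m + 1) ^ 2) * (2 * of_nat m + 1) :: rat)"
    using step.hyps by (simp add: mult_ac)
  also have "\<dots> = (4 * (of_nat N + 1 - of_nat m) * (of_nat N + of_nat m + 2)) * (4 ^ N * (-1) ^ m * fact (N - m) * fact (N + m + 1))"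
    unfolding step.IH by (simp add: power2_eq_square algebra_simps)
  also have "\<dots> = 4 ^ Suc N * (-1) ^ m * fact (Suc N - m) * fact (Suc N + m + 1)"
  proof -
    have f: "fact (Suc N - m) = ((of_nat N + 1 - of_nat m) * fact (N - m) :: rat)"
      using step by (simp add: Suc_diff_le of_nat_diff algebra_simps)
    show ?thesis
      unfolding f by (simp add: algebra_simps)
  qed
  finally show ?case .
qed

text \<open>Lagrange interpolation of \<open>wp_poly N\<close> at 0 with the squares of the first
  \<open>N+1\<close> odd numbers as nodes. The value at 0 is \<open>(N!)^2\<close> times the wanted
  sum.\<close>

lemma sum_eq_dual_sum:
  "(\<Sum>k\<le>N. (3 * of_nat k + 1) / 16 ^ k * of_nat (2 * k choose k) ^ 3)
     = ((\<Prod>l\<le>N. 2 * of_nat l + 1) / (2 ^ N * fact N)) ^ 2 *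
       (\<Sum>i\<le>N div 2. (-1) ^ i * fact (3 * N + 1 - 2 * i)
          / (fact (N - 2 * i) * fact i * fact (2 * N + 1 - i) * of_nat (2 * N + 1 - 2 * i)) :: rat)"
proof -
  let ?S = "\<Sum>k\<le>N. (3 * of_nat k + 1) / 16 ^ k * of_nat (2 * k choose k) ^ 3 :: rat"
  define D :: rat where "D = (\<Prod>l\<le>N. 2 * of_nat l + 1)"
  define y :: "nat \<Rightarrow> rat" where "y m = 2 * of_nat m + 1" for m
  \<comment> \<open>\<open>g m\<close> is the contribution of the node \<open>y m ^ 2\<close>. It is
    0 for \<open>2m < N\<close>, since then \<open>j = 2m+1\<close> occurs in the product of the
    \<open>j^2 - y^2\<close>.\<close>
  define g where "g m = (if N \<le> 2 * m then (-1) ^ (N + m) * D ^ 2 * fact (2 * m + 1 + N)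
      / (4 ^ N * fact (2 * m - N) * fact (N - m) * fact (N + m + 1) * y m) else 0)" for m
  have y0: "y m > 0" for m
    by (simp add: y_def add_nonneg_pos)
  have inj: "inj_on (\<lambda>m. y m ^ 2) {..N}"
    using y0 by (intro inj_onI) (simp add: power2_eq_iff_nonneg less_imp_le, simp add: y_def)
  have val: "y m * (\<Prod>j = 1..N. of_nat j ^ 2 - y m ^ 2) * (\<Prod>l\<in>{..N} - {m}. (0 - y l ^ 2) / (y m ^ 2 - y l ^ 2)) = g m"
    if "m \<le> N" for m
  proof (cases "N \<le> 2 * m")
    case True
    have "(\<Prod>j = 1..N. of_nat j ^ 2 - of_nat (2 * m + 1) ^ 2) * (of_nat (2 * m + 1) * fact (2 * m - N))
        = ((-1) ^ N * fact (2 * m + 1 + N) :: rat)"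
      using prod_squares_diff[of N "2 * m + 1"] True by simp
    hence P: "y m * (\<Prod>j = 1..N. of_nat j ^ 2 - y m ^ 2) = (-1) ^ N * fact (2 * m + 1 + N) / fact (2 * m - N)"
      by (simp add: y_def field_simps)
    have Q: "(\<Prod>l\<in>{..N} - {m}. y l ^ 2 - y m ^ 2) = 4 ^ N * (-1) ^ m * fact (N - m) * fact (N + m + 1) / y m"
      using prod_odd_squares_diff[OF that] y0[of m] by (simp add: y_def eq_divide_eq)
    have "D = y m * (\<Prod>l\<in>{..N} - {m}. y l)"
      using that by (simp add: D_def y_def prod.remove)
    hence R: "(\<Prod>l\<in>{..N} - {m}. y l ^ 2) = D ^ 2 / y m ^ 2"
      using y0[of m] by (simp add: prod_power_distrib power_mult_distrib)
    have "(\<Prod>l\<in>{..N} - {m}. (0 - y l ^ 2) / (y m ^ 2 - y l ^ 2)) = (\<Prod>l\<in>{..N} - {m}. y l ^ 2 / (y l ^ 2 - y m ^ 2))"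
      by (intro prod.cong refl) (metis diff_0 minus_diff_eq minus_divide_divide)
    also have "\<dots> = (D ^ 2 / y m ^ 2) / (4 ^ N * (-1) ^ m * fact (N - m) * fact (N + m + 1) / y m)"
      unfolding prod_dividef Q R ..
    finally have T: "(\<Prod>l\<in>{..N} - {m}. (0 - y l ^ 2) / (y m ^ 2 - y l ^ 2))
      = (-1) ^ m * D ^ 2 / (4 ^ N * fact (N - m) * fact (N + m + 1) * y m)"
      using y0[of m] by (cases "even m") (simp_all add: power2_eq_square)
    show ?thesis
      unfolding P T using True by (simp add: g_def power_add mult_ac)
  next
    case False
    hence "(\<Prod>j = 1..N. of_nat j ^ 2 - y m ^ 2) = 0"
      by (intro prod_zero bexI[of _ "2 * m + 1"]) (auto simp: y_def)
    thus ?thesis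
      using False by (simp add: g_def)
  qed
  have "poly (wp_poly N) 0 = (\<Prod>j = 1..N. of_nat j ^ 2) * ?S"
    using poly_wp_poly[of N 0] by (simp add: wp_term_zero)
  also have "(\<Prod>j = 1..N. of_nat j ^ 2) = (fact N ^ 2 :: rat)"
    by (simp add: fact_prod prod_power_distrib)
  finally have "fact N ^ 2 * ?S = poly (wp_poly N) 0" ..
  also have "\<dots> = (\<Sum>a\<in>(\<lambda>m. y m ^ 2) ` {..N}. poly (wp_poly N) a *
      (\<Prod>b\<in>(\<lambda>m. y m ^ 2) ` {..N} - {a}. (0 - b) / (a - b)))"
    using degree_wp_poly[of N] card_image[OF inj] by (intro lagrange_interpolation) auto
  also have "\<dots> = (\<Sum>m\<le>N. poly (wp_poly N) (y m ^ 2) *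
      (\<Prod>b\<in>(\<lambda>m. y m ^ 2) ` {..N} - {y m ^ 2}. (0 - b) / (y m ^ 2 - b)))"
    by (simp add: sum.reindex[OF inj])
  also have "\<dots> = (\<Sum>m\<le>N. g m)"
  proof (rule sum.cong)
    fix m assume m: "m \<in> {..N}"
    have img: "(\<lambda>m. y m ^ 2) ` {..N} - {y m ^ 2} = (\<lambda>m. y m ^ 2) ` ({..N} - {m})"
      using inj_on_image_set_diff[OF inj, of "{..N}" "{m}"] m by simp
    have inj': "inj_on (\<lambda>m. y m ^ 2) ({..N} - {m})"
      using inj by (rule inj_on_subset) auto
    have "poly (wp_poly N) (y m ^ 2) = y m * (\<Prod>j = 1..N. of_nat j ^ 2 - y m ^ 2)"
      using poly_wp_poly_odd[of m N] m by (simp add: y_def)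
    moreover have "(\<Prod>b\<in>(\<lambda>m. y m ^ 2) ` ({..N} - {m}). (0 - b) / (y m ^ 2 - b))
        = (\<Prod>l\<in>{..N} - {m}. (0 - y l ^ 2) / (y m ^ 2 - y l ^ 2))"
      by (simp only: prod.reindex[OF inj'] o_def)
    ultimately show "poly (wp_poly N) (y m ^ 2) *
        (\<Prod>b\<in>(\<lambda>m. y m ^ 2) ` {..N} - {y m ^ 2}. (0 - b) / (y m ^ 2 - b)) = g m"
      using val[of m] m unfolding img by simp
  qed simp
  \<comment> \<open>Counting from the largest node, \<open>m = N - i\<close>, turns the condition
    \<open>N \<le> 2m\<close> into \<open>2i \<le> N\<close>.\<close>
  also have "\<dots> = (\<Sum>i\<le>N. g (N - i))"
    by (rule sum.reindex_bij_witness[of _ "\<lambda>i. N - i" "\<lambda>i. N - i"]) auto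
  also have "\<dots> = (\<Sum>i\<le>N div 2. g (N - i))"
    by (intro sum.mono_neutral_right) (auto simp: g_def)
  also have "\<dots> = (\<Sum>i\<le>N div 2. D ^ 2 / 4 ^ N * ((-1) ^ i * fact (3 * N + 1 - 2 * i)
          / (fact (N - 2 * i) * fact i * fact (2 * N + 1 - i) * of_nat (2 * N + 1 - 2 * i))))"
  proof (rule sum.cong)
    fix i assume "i \<in> {..N div 2}"
    hence "2 * i \<le> N"
      by auto
    then obtain r where N: "N = 2 * i + r"
      using le_Suc_ex by blast
    have a: "N - i = i + r" "2 * (i + r) + 1 + N = 3 * N + 1 - 2 * i" "2 * (i + r) - N = N - 2 * i"
      "N - (i + r) = i" "N + (i + r) + 1 = 2 * N + 1 - i" "N \<le> 2 * (i + r)"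
      by (simp_all add: N)
    have b: "y (i + r) = of_nat (2 * N + 1 - 2 * i)"
      by (simp add: y_def N algebra_simps)
    have "N + (i + r) = i + 2 * (i + r)"
      by (simp add: N)
    hence c: "(-1) ^ (N + (i + r)) = ((-1) ^ i :: rat)"
      by (simp only: power_add power_mult) simp
    show "g (N - i) = D ^ 2 / 4 ^ N * ((-1) ^ i * fact (3 * N + 1 - 2 * i)
          / (fact (N - 2 * i) * fact i * fact (2 * N + 1 - i) * of_nat (2 * N + 1 - 2 * i)))"
      unfolding a(1) g_def a(2-5) b c using a(6) by (simp add: mult_ac)
  qed simp
  also have "\<dots> = D ^ 2 / 4 ^ N * (\<Sum>i\<le>N div 2. (-1) ^ i * fact (3 * N + 1 - 2 * i)
          / (fact (N - 2 * i) * fact i * fact (2 * N + 1 - i) * of_nat (2 * N + 1 - 2 * i)))"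
    by (simp only: sum_distrib_left)
  finally have "fact N ^ 2 * ?S = D ^ 2 / 4 ^ N * (\<Sum>i\<le>N div 2. (-1) ^ i * fact (3 * N + 1 - 2 * i)
          / (fact (N - 2 * i) * fact i * fact (2 * N + 1 - i) * of_nat (2 * N + 1 - 2 * i)))" .
  moreover have "(2 ^ N) ^ 2 = (4 ^ N :: rat)"
    by (simp add: power2_eq_square flip: power_mult_distrib)
  hence "(D / (2 ^ N * fact N)) ^ 2 = D ^ 2 / 4 ^ N / fact N ^ 2"
    by (simp add: power_divide power_mult_distrib)
  ultimately show ?thesis
    by (simp add: D_def field_simps)
qed

section \<open>The sum as a combination of shifted factorials\<close>

text \<open>This is the generalized binomial coefficient \<open>x + r\<close> over \<open>r\<close>,
  written so that every factor is visibly 1 modulo \<open>p\<close> when \<open>x\<close> is a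
  \<open>p\<close>-integral multiple of \<open>p\<close> and \<open>r < p\<close>.\<close>

definition shifted_fact :: "nat \<Rightarrow> rat \<Rightarrow> rat" where
  "shifted_fact r x = (\<Prod>s = 1..r. 1 + x / of_nat s)"

lemma fact_add_eq: "fact (p + r) = fact p * fact r * shifted_fact r (of_nat p)"
proof (induction r)
  case (Suc r)
  have "fact (p + Suc r) = (of_nat p + of_nat r + 1) * fact (p + r) "
    by (simp add: add_ac)
  also have "\<dots> = fact p * fact (Suc r) * (shifted_fact r (of_nat p) * (1 + of_nat p / of_nat (Suc r)))"
    unfolding Suc.IH by (simp add: field_simps del: of_nat_Suc) (simp add: algebra_simps)
  finally show ?case
    by (simp add: shifted_fact_def)
qed (simp add: shifted_fact_def)

text \<open>The top \<open>k\<close> factors of \<open>(p-1)!\<close> are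
  \<open>p-s = -s(1-p/s)\<close> for \<open>s = 1..k\<close>.\<close>

lemma fact_pred_eq:
  "k < p \<Longrightarrow> fact (p - 1) = fact (p - 1 - k) * (-1) ^ k * fact k * shifted_fact k (- of_nat p)"
proof (induction k)
  case (Suc k)
  have *: "fact (p - 1 - k) = ((of_nat p - of_nat (Suc k)) * fact (p - 1 - Suc k) :: rat)"
    using Suc.prems fact_reduce[of "p - 1 - k", where 'a = rat] by (simp add: of_nat_diff)
  have "(1 + - of_nat p / of_nat (Suc k)) * of_nat (Suc k) = (of_nat (Suc k) - of_nat p :: rat)"
    by (simp add: field_simps del: of_nat_Suc)
  hence **: "shifted_fact (Suc k) (- of_nat p) * of_nat (Suc k) = shifted_fact k (- of_nat p) * (of_nat (Suc k) - of_nat p)"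
    by (simp add: shifted_fact_def mult.assoc del: of_nat_Suc)
  have "fact (p - 1 - Suc k) * (-1) ^ Suc k * fact (Suc k) * shifted_fact (Suc k) (- of_nat p)
      = - fact (p - 1 - Suc k) * (-1) ^ k * fact k * (shifted_fact (Suc k) (- of_nat p) * of_nat (Suc k))"
    by (simp del: of_nat_Suc)
  also have "\<dots> = fact (p - 1 - k) * (-1) ^ k * fact k * shifted_fact k (- of_nat p)"
    unfolding * ** by (simp add: algebra_simps)
  finally show ?case
    using Suc by simp
qed (simp add: shifted_fact_def)

text \<open>The factor \<open>l = N\<close> is \<open>p\<close>. The other odd numbers are
  \<open>p-2j = -2j(1-(p/2)/j)\<close> for \<open>j = 1..N\<close>.\<close>

lemma prod_odd_eq:
  assumes "p = 2 * N + 1"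
  shows "(\<Prod>l\<le>N. 2 * of_nat l + 1) / (2 ^ N * fact N) = (-1) ^ N * of_nat p * shifted_fact N (- (1 / 2) * of_nat p)"
proof -
  have "(\<Prod>l<N. 2 * of_nat l + 1) = (\<Prod>j = 1..N. of_nat p - 2 * of_nat j :: rat)"
    by (rule prod.reindex_bij_witness[of _ "\<lambda>j. N - j" "\<lambda>l. N - l"])
      (auto simp: assms of_nat_diff)
  also have "\<dots> = (\<Prod>j = 1..N. (- 2) * of_nat j * (1 + - (1 / 2) * of_nat p / of_nat j))"
    by (intro prod.cong refl) (simp add: field_simps)
  also have "\<dots> = (-1) ^ N * 2 ^ N * fact N * shifted_fact N (- (1 / 2) * of_nat p)"
    unfolding prod.distrib shifted_fact_def by (simp add: fact_prod flip: power_mult_distrib)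
  finally show ?thesis
    by (simp add: assms flip: lessThan_Suc_atMost)
qed

text \<open>In the dual sum \<open>3N+1-2i = p+(N-2i)\<close> and \<open>2N+1-i = p-i\<close>. The
  term \<open>i = 0\<close> contains \<open>1/p\<close> from its odd denominator, the others a
  factor \<open>p\<close> from \<open>p!/(p-i)!\<close>, and the squared prefactor supplies
  \<open>p^2\<close>.\<close>

lemma sum_eq_shifted_facts:
  assumes p: "p = 2 * N + 1"
  shows "(\<Sum>k\<le>N. (3 * of_nat k + 1) / 16 ^ k * of_nat (2 * k choose k) ^ 3)
     = of_nat p * shifted_fact N (- (1 / 2) * of_nat p) ^ 2 * (shifted_fact N (of_nat p) + of_nat p ^ 2 *
       (\<Sum>i = 1..N div 2. shifted_fact (N - 2 * i) (of_nat p) * shifted_fact (i - 1) (- of_nat p)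
          / (of_nat i * (2 * of_nat i - of_nat p))))"
proof -
  let ?t = "\<lambda>i. (-1) ^ i * fact (3 * N + 1 - 2 * i)
          / (fact (N - 2 * i) * fact i * fact (2 * N + 1 - i) * of_nat (2 * N + 1 - 2 * i)) :: rat"
  have p0: "of_nat p \<noteq> (0 :: rat)"
    by (simp add: p)
  have 0: "?t 0 = shifted_fact N (of_nat p) / of_nat p"
    using fact_add_eq[of p N] by (simp add: p add_ac)
  have i: "?t i = of_nat p * (shifted_fact (N - 2 * i) (of_nat p) * shifted_fact (i - 1) (- of_nat p)
          / (of_nat i * (2 * of_nat i - of_nat p)))" if "i \<in> {1..N div 2}" for i
  proof -
    from that obtain k r where k: "i = Suc k" "N = 2 * i + r"
      by (metis atLeastAtMost_iff le_Suc_ex not0_implies_Suc not_one_le_zero times_div_less_eq_dividend mult_le_mono2 le_trans)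
    have e: "3 * N + 1 - 2 * i = p + r" "N - 2 * i = r" "2 * N + 1 - i = p - 1 - k" "2 * N + 1 = p" "i - 1 = k" "p - i = p - 1 - k"
      by (simp_all add: k p)
    have nz: "2 * of_nat i - of_nat p \<noteq> (0 :: rat)" "of_nat p - 2 * of_nat i \<noteq> (0 :: rat)"
      by (simp_all add: k p)
    have f: "fact p = of_nat p * (fact (p - 1 - k) * (-1) ^ k * fact k * shifted_fact k (- of_nat p))"
      using fact_pred_eq[of k p] fact_reduce[of p, where 'a = rat] by (simp add: k p)
    have g: "of_nat (p - 2 * i) = (of_nat p - 2 * of_nat i :: rat)"
      by (simp add: k p)
    have h: "fact i = (of_nat i * fact k :: rat)"
      by (simp add: k)
    have s: "(-1) ^ i * (-1) ^ k = (-1 :: rat)"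
      by (simp add: k flip: power_add mult_2)
    have "?t i = (-1) ^ i * (-1) ^ k * of_nat p * shifted_fact r (of_nat p) * shifted_fact k (- of_nat p)
        / (of_nat i * (of_nat p - 2 * of_nat i))"
      unfolding e fact_add_eq f g h by simp
    also have "\<dots> = of_nat p * (shifted_fact r (of_nat p) * shifted_fact k (- of_nat p) / (of_nat i * (2 * of_nat i - of_nat p)))"
      unfolding s using nz by (simp add: divide_simps) (simp add: algebra_simps)
    finally show ?thesis
      unfolding e .
  qed
  have "{..N div 2} = insert 0 {1..N div 2}"
    by auto
  hence "(\<Sum>i\<le>N div 2. ?t i) = ?t 0 + (\<Sum>i = 1..N div 2. ?t i)"
    by (simp only: sum.insert finite_atLeastAtMost) simp
  also have "(\<Sum>i = 1..N div 2. ?t i) = of_nat p * (\<Sum>i = 1..N div 2. shifted_fact (N - 2 * i) (of_nat p) * shifted_fact (i - 1) (- of_nat p)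
          / (of_nat i * (2 * of_nat i - of_nat p)))"
    unfolding sum_distrib_left using i by (rule sum.cong[OF refl])
  finally have sum: "(\<Sum>i\<le>N div 2. ?t i) = shifted_fact N (of_nat p) / of_nat p + of_nat p *
      (\<Sum>i = 1..N div 2. shifted_fact (N - 2 * i) (of_nat p) * shifted_fact (i - 1) (- of_nat p)
          / (of_nat i * (2 * of_nat i - of_nat p)))"
    unfolding 0 .
  have "(s * q * r) ^ 2 * (e / q + q * t) = q * r ^ 2 * (e + q ^ 2 * t)" if "s ^ 2 = 1" "q \<noteq> 0" for q r s e t :: rat
    using that by (simp add: power_mult_distrib) (simp add: power2_eq_square field_simps)
  thus ?thesis
    unfolding sum_eq_dual_sum prod_odd_eq[OF p] sum using p0 by (simp add: flip: power_mult)
qed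

section \<open>Congruences between p-integral rationals\<close>

text \<open>The localization of the integers at \<open>p\<close>. Fractions may be unreduced, which
  makes closure under sums and products immediate; \<open>b = 0\<close> is excluded because
  \<open>p\<close> divides 0.\<close>

definition p_integral :: "nat \<Rightarrow> rat \<Rightarrow> bool" where
  "p_integral p x \<longleftrightarrow> (\<exists>a b. \<not> int p dvd b \<and> x = of_int a / of_int b)"

text \<open>Congruence modulo the first power of \<open>p\<close> only. Higher powers are carried as
  explicit \<open>p\<close>-integral remainders.\<close>

definition p_cong :: "nat \<Rightarrow> rat \<Rightarrow> rat \<Rightarrow> bool" where
  "p_cong p x y \<longleftrightarrow> p_integral p ((x - y) / of_nat p)"

text \<open>Cross-multiplying with the reduced fraction \<open>n/e\<close> gives
  \<open>n d = p^r c e\<close> with \<open>p\<close> prime to \<open>d\<close>, so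
  \<open>p^r\<close> divides \<open>n\<close>. If \<open>p\<close> divided \<open>e\<close>, it
  would divide \<open>n\<close> too, against coprimality.\<close>

lemma rat_congI:
  assumes "prime p" and "p_integral p z" and "a - b = of_nat p ^ r * z"
  shows "rat_cong p r a b"
proof -
  obtain c d where d: "\<not> int p dvd d" and z: "z = of_int c / of_int d"
    using assms(2) by (auto simp: p_integral_def)
  obtain n e where q: "quotient_of (a - b) = (n, e)"
    by fastforce
  have e: "e > 0" and ne: "coprime n e" and ab: "a - b = of_int n / of_int e"
    using q quotient_of_denom_pos quotient_of_coprime quotient_of_div by auto
  have p: "prime (int p)"
    using assms(1) by simp
  have "d \<noteq> 0"
    using d by auto
  hence "of_int (n * d) = (of_int (int p ^ r * c * e) :: rat)"
    using assms(3) e by (simp add: ab z field_simps)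
  hence eq: "n * d = int p ^ r * c * e"
    by (simp only: of_int_eq_iff)
  have "coprime (int p ^ r) d"
    using p d by (simp add: prime_imp_coprime)
  moreover have "int p ^ r dvd n * d"
    using eq by (simp add: mult.assoc)
  ultimately have "int p ^ r dvd n"
    by (simp add: coprime_dvd_mult_left_iff)
  moreover have "coprime e (int p)"
  proof -
    have "\<not> int p dvd e"
    proof
      assume dvd: "int p dvd e"
      hence "int p dvd n * d"
        using eq by simp
      hence "int p dvd n"
        using p d prime_dvd_mult_iff by blast
      thus False
        using dvd ne p by (meson coprime_common_divisor not_prime_unit)
    qed
    thus ?thesis
      using p prime_imp_coprime[of "int p" e] by (simp add: coprime_commute)
  qed
  ultimately show ?thesis
    by (simp add: rat_cong_def q)
qed

context
  fixes p :: nat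
  assumes prime: "prime p"
begin

lemma p_pos: "of_nat p > (0 :: rat)"
  using prime by (simp add: prime_gt_0_nat)

lemma p_integral_of_int [simp]: "p_integral p (of_int a)"
  unfolding p_integral_def using prime by (intro exI[of _ a] exI[of _ 1]) auto

lemma p_integral_of_nat [simp]: "p_integral p (of_nat n)"
  using p_integral_of_int[of "int n"] by simp

lemma p_integral_0 [simp]: "p_integral p 0" and p_integral_1 [simp]: "p_integral p 1"
  and p_integral_numeral [simp]: "p_integral p (numeral k)"
  using p_integral_of_nat[of 0] p_integral_of_nat[of 1] p_integral_of_nat[of "numeral k"] by simp_all

lemma p_integral_add [simp]: "p_integral p x \<Longrightarrow> p_integral p y \<Longrightarrow> p_integral p (x + y)"
  and p_integral_mult [simp]: "p_integral p x \<Longrightarrow> p_integral p y \<Longrightarrow> p_integral p (x * y)"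
proof -
  assume "p_integral p x" "p_integral p y"
  then obtain a b c d where *: "\<not> int p dvd b" "x = of_int a / of_int b" "\<not> int p dvd d" "y = of_int c / of_int d"
    by (auto simp: p_integral_def)
  have nz: "b \<noteq> 0" "d \<noteq> 0"
    using * by auto
  have bd: "\<not> int p dvd b * d"
    using * prime by (simp add: prime_dvd_mult_iff)
  have "x + y = of_int (a * d + c * b) / of_int (b * d)" "x * y = of_int (a * c) / of_int (b * d)"
    using nz by (simp_all add: * field_simps)
  thus "p_integral p (x + y)" "p_integral p (x * y)"
    unfolding p_integral_def using bd by blast+
qed

lemma p_integral_uminus [simp]: "p_integral p x \<Longrightarrow> p_integral p (- x)"
  using p_integral_mult[of "- 1" x] p_integral_of_int[of "-1"] by simp

lemma p_integral_diff [simp]: "p_integral p x \<Longrightarrow> p_integral p y \<Longrightarrow> p_integral p (x - y)"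
  using p_integral_add[of x "- y"] by simp

lemma p_integral_power [simp]: "p_integral p x \<Longrightarrow> p_integral p (x ^ n)"
  by (induction n) auto

lemma p_integral_sum [simp]: "(\<And>i. i \<in> A \<Longrightarrow> p_integral p (f i)) \<Longrightarrow> p_integral p (sum f A)"
  by (induction A rule: infinite_finite_induct) auto

lemma p_integral_divide: "p_integral p x \<Longrightarrow> \<not> int p dvd b \<Longrightarrow> p_integral p (x / of_int b)"
proof -
  assume x: "p_integral p x" and b: "\<not> int p dvd b"
  have "p_integral p (1 / of_int b)"
    unfolding p_integral_def using b by (intro exI[of _ 1] exI[of _ b]) auto
  from p_integral_mult[OF x this] show ?thesis
    by simp
qed

lemma p_integral_divide_nat:
  assumes "p_integral p x" "0 < n" "n < p"
  shows "p_integral p (x / of_nat n)"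
  using p_integral_divide[of x "int n"] assms by (simp add: nat_dvd_not_less)

lemma p_congI: "p_integral p z \<Longrightarrow> x = y + of_nat p * z \<Longrightarrow> p_cong p x y"
  using p_pos by (simp add: p_cong_def)

lemma p_congE:
  assumes "p_cong p x y"
  obtains z where "p_integral p z" "x = y + of_nat p * z"
  using assms p_pos by (intro that[of "(x - y) / of_nat p"]) (simp_all add: p_cong_def)

lemma p_cong_refl [simp]: "p_cong p x x"
  by (simp add: p_cong_def)

lemma p_cong_sym: "p_cong p x y \<Longrightarrow> p_cong p y x"
  unfolding p_cong_def using p_integral_uminus[of "(x - y) / of_nat p"] by (simp add: minus_divide_left)

lemma p_cong_add: "p_cong p x y \<Longrightarrow> p_cong p u v \<Longrightarrow> p_cong p (x + u) (y + v)"
  unfolding p_cong_def using p_integral_add[of "(x - y) / of_nat p" "(u - v) / of_nat p"]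
  by (simp add: add_divide_distrib diff_divide_distrib algebra_simps)

lemma p_cong_trans: "p_cong p x y \<Longrightarrow> p_cong p y z \<Longrightarrow> p_cong p x z"
  using p_cong_add[of x y y z] by (simp add: p_cong_def)

lemma p_cong_mult:
  assumes "p_cong p x y" "p_cong p u v" "p_integral p y" "p_integral p v"
  shows "p_cong p (x * u) (y * v)"
proof -
  obtain z w where zw: "p_integral p z" "x = y + of_nat p * z" "p_integral p w" "u = v + of_nat p * w"
    using assms(1,2) by (metis p_congE)
  show ?thesis
    using assms zw by (intro p_congI[of "y * w + z * v + of_nat p * z * w"]) (simp_all add: algebra_simps)
qed

lemma p_cong_mult_left: "p_cong p u v \<Longrightarrow> p_integral p c \<Longrightarrow> p_cong p (c * u) (c * v)"
  unfolding p_cong_def using p_integral_mult[of c "(u - v) / of_nat p"] by (simp add: right_diff_distrib)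

lemma p_cong_sum: "(\<And>i. i \<in> A \<Longrightarrow> p_cong p (f i) (g i)) \<Longrightarrow> p_cong p (sum f A) (sum g A)"
  by (induction A rule: infinite_finite_induct) (auto intro: p_cong_add)

section \<open>Shifted factorials modulo powers of p\<close>

lemma shifted_fact_cong:
  assumes "p_integral p c" and "r < p"
  shows "p_integral p (shifted_fact r (c * of_nat p)) \<and> p_cong p (shifted_fact r (c * of_nat p)) 1"
  using assms(2)
proof (induction r)
  case 0
  then show ?case by (simp add: shifted_fact_def)
next
  case (Suc r)
  have int: "p_integral p (c / of_nat (Suc r))"
    using assms Suc.prems by (intro p_integral_divide_nat) auto
  have eq: "1 + c * of_nat p / of_nat (Suc r) = 1 + of_nat p * (c / of_nat (Suc r))"
    by simp
  have cong: "p_cong p (1 + c * of_nat p / of_nat (Suc r)) 1"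
    using int eq by (rule p_congI)
  have "shifted_fact (Suc r) (c * of_nat p) = shifted_fact r (c * of_nat p) * (1 + c * of_nat p / of_nat (Suc r))"
    by (simp add: shifted_fact_def)
  moreover have "p_integral p (1 + c * of_nat p / of_nat (Suc r))"
    unfolding eq by (intro p_integral_add p_integral_mult int) simp_all
  moreover have "p_cong p (shifted_fact r (c * of_nat p) * (1 + c * of_nat p / of_nat (Suc r))) (1 * 1)"
    using Suc cong by (intro p_cong_mult) auto
  ultimately show ?case
    using Suc by simp
qed

text \<open>Each index \<open>j\<close> contributes \<open>(1 - x/2)^2 (1 + x)\<close> with
  \<open>x = p/j\<close>. The linear terms cancel, leaving
  \<open>1 - 3x^2/4 + x^3/4\<close>.\<close>

lemma shifted_fact_prod_expansion:
  assumes "N < p" and "p_integral p (1 / 4)"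
  shows "\<exists>z. p_integral p z \<and> shifted_fact N (- (1 / 2) * of_nat p) ^ 2 * shifted_fact N (of_nat p)
     = 1 - 3 / 4 * of_nat p ^ 2 * (\<Sum>j = 1..N. 1 / of_nat j ^ 2) + of_nat p ^ 3 * z"
  using assms(1)
proof (induction N)
  case 0
  then show ?case by (intro exI[of _ 0]) (simp add: shifted_fact_def)
next
  case (Suc N)
  then obtain z where z: "p_integral p z" "shifted_fact N (- (1 / 2) * of_nat p) ^ 2 * shifted_fact N (of_nat p)
     = 1 - 3 / 4 * of_nat p ^ 2 * (\<Sum>j = 1..N. 1 / of_nat j ^ 2) + of_nat p ^ 3 * z"
    by auto
  define q :: rat where "q = of_nat p"
  define H :: rat where "H = (\<Sum>j = 1..N. 1 / of_nat j ^ 2)"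
  define u :: rat where "u = 1 / of_nat (Suc N)"
  define v :: rat where "v = 1 / 4"
  have "p_integral p u"
    unfolding u_def using Suc.prems by (intro p_integral_divide_nat) auto
  hence int: "p_integral p q" "p_integral p u" "p_integral p H" "p_integral p v"
    using Suc.prems assms(2)
    by (auto simp: q_def H_def v_def power_one_over[symmetric] intro!: p_integral_divide_nat p_integral_sum p_integral_power)
  have "shifted_fact (Suc N) (- (1 / 2) * q) ^ 2 * shifted_fact (Suc N) q =
     (shifted_fact N (- (1 / 2) * q) ^ 2 * shifted_fact N q) * ((1 - q * u / 2) ^ 2 * (1 + q * u))"
    by (simp add: shifted_fact_def u_def power_mult_distrib mult.commute del: of_nat_Suc)
  also have "(1 - q * u / 2) ^ 2 * (1 + q * u) = 1 - 3 * v * q ^ 2 * u ^ 2 + q ^ 3 * (v * u ^ 3)"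
    by (simp add: v_def power2_eq_square power3_eq_cube algebra_simps)
  also have "shifted_fact N (- (1 / 2) * q) ^ 2 * shifted_fact N q = 1 - 3 * v * q ^ 2 * H + q ^ 3 * z"
    using z(2) by (simp add: q_def H_def v_def)
  also have "(1 - 3 * v * q ^ 2 * H + q ^ 3 * z) * (1 - 3 * v * q ^ 2 * u ^ 2 + q ^ 3 * (v * u ^ 3)) =
     1 - 3 * v * q ^ 2 * (H + u ^ 2) + q ^ 3 * (v * u ^ 3 * (1 - 3 * v * q ^ 2 * H + q ^ 3 * z)
        + z * (1 - 3 * v * q ^ 2 * u ^ 2) + 9 * v ^ 2 * q * H * u ^ 2)"
    by (simp add: power2_eq_square power3_eq_cube algebra_simps)
  finally have eq: "shifted_fact (Suc N) (- (1 / 2) * q) ^ 2 * shifted_fact (Suc N) q =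
     1 - 3 * v * q ^ 2 * (H + u ^ 2) + q ^ 3 * (v * u ^ 3 * (1 - 3 * v * q ^ 2 * H + q ^ 3 * z)
        + z * (1 - 3 * v * q ^ 2 * u ^ 2) + 9 * v ^ 2 * q * H * u ^ 2)" (is "_ = _ + q ^ 3 * ?Z") .
  have H: "H + u ^ 2 = (\<Sum>j = 1..Suc N. 1 / of_nat j ^ 2)" and v: "3 * v = 3 / 4"
    by (simp_all add: H_def u_def v_def power_one_over)
  have "p_integral p ?Z"
    using int z(1) by simp
  thus ?case
    using eq unfolding H v q_def by blast
qed

end

section \<open>Euler numbers\<close>

text \<open>Euler's criterion gives the congruence modulo \<open>p\<close>; both sides have absolute
  value at most 1, so they differ by at most \<open>2 < p\<close>.\<close>

lemma Legendre_minus_one: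
  assumes "prime p" and "p = 2 * N + 1"
  shows "Legendre (-1) (int p) = (-1) ^ N"
proof -
  have "p > 2"
    using assms prime_ge_2_nat[of p] by (cases "p = 2") auto
  hence "[Legendre (-1) (int p) = (-1) ^ N] (mod int p)"
    using euler_criterion[OF assms(1), of "-1"] assms(2) by simp
  hence dvd: "int p dvd Legendre (-1) (int p) - (-1) ^ N"
    by (simp add: cong_iff_dvd_diff)
  have "\<bar>Legendre (-1) (int p) - (-1) ^ N\<bar> \<le> 2"
    by (cases "even N") (auto simp: Legendre_def)
  thus ?thesis
    using dvd \<open>p > 2\<close> zdvd_not_zless[of "\<bar>Legendre (-1) (int p) - (-1) ^ N\<bar>" "int p"] by fastforce
qed

text \<open>The alternating sum over \<open>j = -N..N\<close>, with \<open>j\<close> and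
  \<open>-j\<close> paired, is geometric: after multiplication neighbouring terms cancel and only
  the two ends survive.\<close>

lemma fps_exp_alternating_sum:
  "(fps_exp 1 + fps_exp (-1)) * (1 + (\<Sum>j = 1..N. fps_const ((-1) ^ j) * (fps_exp (2 * of_nat j) + fps_exp (- (2 * of_nat j)))))
     = fps_const ((-1) ^ N) * (fps_exp (2 * of_nat N + 1) + fps_exp (- (2 * of_nat N + 1)) :: rat fps)"
proof (induction N)
  case (Suc N)
  let ?x = "2 * of_nat N :: rat"
  have *: "fps_exp (2 * of_nat (Suc N)) = fps_exp (?x + 1) * fps_exp 1"
    "fps_exp (- (2 * of_nat (Suc N))) = fps_exp (- (?x + 1)) * fps_exp (- 1)"
    "fps_exp (2 * of_nat (Suc N) + 1) = fps_exp (?x + 1) * fps_exp 1 * fps_exp (1 :: rat)"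
    "fps_exp (- (2 * of_nat (Suc N) + 1)) = fps_exp (- (?x + 1)) * fps_exp (- 1) * fps_exp (- 1 :: rat)"
    by (simp_all add: algebra_simps flip: fps_exp_add_mult)
  have **: "fps_exp 1 * fps_exp (- 1) = (1 :: rat fps)"
    by (simp flip: fps_exp_add_mult)
  have neg: "fps_const ((-1) ^ Suc N) = - (fps_const ((-1) ^ N) :: rat fps)"
    by simp
  \<comment> \<open>Here \<open>e\<close>, \<open>f\<close> are the exponentials of \<open>t\<close>
    and \<open>-t\<close>, and \<open>a\<close>, \<open>b\<close> the outermost ones for
    \<open>N\<close>. By \<open>e * f = 1\<close> the new pair reproduces
    \<open>c * (a + b)\<close>, which cancels the old ends.\<close>
  have step: "(e + f) * (1 + (S + - c * (a * e + b * f))) = - c * (a * e * e + b * f * f)"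
    if "(e + f) * (1 + S) = c * (a + b)" "e * f = 1" for e f S c a b :: "rat fps"
  proof -
    have "(e + f) * (1 + (S + - c * (a * e + b * f))) = (e + f) * (1 + S) - c * (a * e * e + b * f * f + (e * f) * (a + b))"
      by (simp add: algebra_simps)
    thus ?thesis
      unfolding that by (simp add: algebra_simps)
  qed
  have split: "(\<Sum>j = 1..Suc N. g j) = (\<Sum>j = 1..N. g j) + g (Suc N)" for g :: "nat \<Rightarrow> rat fps"
    by simp
  show ?case
    unfolding split * neg by (rule step[OF Suc.IH **])
qed simp

lemma euler_number_fps: "fps_nth (2 / (fps_exp 1 + fps_exp (-1))) n = euler_number n / fact n"
  by (simp add: euler_number_def)

lemma sech_mult: "2 / (fps_exp 1 + fps_exp (-1)) * (fps_exp 1 + fps_exp (-1)) = (2 :: rat fps)"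
proof -
  have "fps_exp 1 + fps_exp (-1) dvd (1 :: rat fps)"
    by (simp add: fps_is_unit_iff)
  hence "fps_exp 1 + fps_exp (-1) dvd (2 :: rat fps)"
    by (rule unit_imp_dvd)
  thus ?thesis
    by simp
qed

lemma fps_nth_sech_mult:
  "fact n * fps_nth (2 / (fps_exp 1 + fps_exp (-1)) * (fps_exp c + fps_exp (-c))) n
    = (\<Sum>i\<le>n. of_nat (n choose i) * euler_number i * (c ^ (n - i) + (- c) ^ (n - i)))"
  unfolding fps_mult_nth sum_distrib_left atLeast0AtMost
proof (rule sum.cong)
  fix i assume "i \<in> {..n}"
  thus "fact n * (fps_nth (2 / (fps_exp 1 + fps_exp (-1))) i * fps_nth (fps_exp c + fps_exp (-c)) (n - i))
     = of_nat (n choose i) * euler_number i * (c ^ (n - i) + (- c) ^ (n - i))"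
    by (simp add: euler_number_fps binomial_fact add_divide_distrib[symmetric])
qed simp

lemma euler_number_recurrence:
  assumes "n > 0"
  shows "(\<Sum>i\<le>n. of_nat (n choose i) * euler_number i * (1 + (- 1) ^ (n - i))) = 0"
  using fps_nth_sech_mult[of n 1] assms by (simp add: sech_mult numeral_fps_const)

text \<open>The coefficient of \<open>t^n\<close> in sech \<open>t\<close> times the two outer
  exponentials, computed in two ways. \<open>n > 0\<close> removes the constant 1, and
  \<open>n\<close> even makes the exponents \<open>2j\<close> and \<open>-2j\<close> contribute
  equally.\<close>

lemma euler_number_sum:
  assumes "n > 0" "even n"
  shows "(\<Sum>i\<le>n. of_nat (n choose i) * euler_number i * ((2 * of_nat N + 1) ^ (n - i) + (- (2 * of_nat N + 1)) ^ (n - i)))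
     = 4 * (-1) ^ N * (\<Sum>j = 1..N. (-1) ^ j * (2 * of_nat j) ^ n)"
proof -
  let ?F = "2 / (fps_exp 1 + fps_exp (-1)) :: rat fps"
  let ?A = "1 + (\<Sum>j = 1..N. fps_const ((-1) ^ j) * (fps_exp (2 * of_nat j) + fps_exp (- (2 * of_nat j)))) :: rat fps"
  let ?B = "fps_exp (2 * of_nat N + 1) + fps_exp (- (2 * of_nat N + 1)) :: rat fps"
  have "fps_const ((-1) ^ N) * fps_const ((-1) ^ N) = (1 :: rat fps)"
    by (simp flip: power_add mult_2)
  hence "?F * ?B = fps_const ((-1) ^ N) * (?F * (fps_const ((-1) ^ N) * ?B))"
    by (simp add: mult_ac)
  also have "\<dots> = fps_const ((-1) ^ N) * (?F * (fps_exp 1 + fps_exp (-1)) * ?A)"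
    unfolding fps_exp_alternating_sum[symmetric] by (simp only: mult.assoc)
  also have "\<dots> = fps_const (2 * (-1) ^ N) * ?A"
    unfolding sech_mult by (simp add: numeral_fps_const mult_ac)
  finally have "fact n * fps_nth (?F * ?B) n = fact n * fps_nth (fps_const (2 * (-1) ^ N) * ?A) n"
    by simp
  also have "\<dots> = 2 * (-1) ^ N * (\<Sum>j = 1..N. (-1) ^ j * (fact n * ((2 * of_nat j) ^ n + (- (2 * of_nat j)) ^ n) / fact n))"
    using assms by (simp add: fps_sum_nth sum_distrib_left add_divide_distrib mult_ac)
  also have "\<dots> = 4 * (-1) ^ N * (\<Sum>j = 1..N. (-1) ^ j * (2 * of_nat j) ^ n)"
    using assms by (simp add: sum_distrib_left mult_ac)
  finally show ?thesis
    unfolding fps_nth_sech_mult .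
qed

section \<open>The congruence\<close>

lemma alternating_sum_eq:
  fixes f :: "nat \<Rightarrow> rat"
  shows "(\<Sum>j = 1..M. (-1) ^ j * f j) = 2 * (\<Sum>i = 1..M div 2. f (2 * i)) - (\<Sum>j = 1..M. f j)"
proof (induction M)
  case (Suc M)
  show ?case
  proof (cases "even M")
    case True
    thus ?thesis using Suc by simp
  next
    case False
    hence "Suc M div 2 = Suc (M div 2)" "2 * Suc (M div 2) = Suc M"
      by presburger+
    thus ?thesis using Suc False by simp
  qed
qed simp

section \<open>Harmonic sums and Euler numbers modulo p\<close>

context
  fixes p N :: nat
  assumes prime: "prime p" and p: "p = 2 * N + 1" and gt3: "p > 3"
begin

lemma p_integral_half_powers: "p_integral p (1 / 2)" "p_integral p (1 / 4)"
  using p_integral_divide_nat[OF prime, of 1 2] p_integral_divide_nat[OF prime, of "1 / 2" 2] gt3 prime by simp_all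

text \<open>The recurrence has integer coefficients and leading coefficient 2, which is invertible
  modulo the odd prime \<open>p\<close>.\<close>

lemma euler_number_p_integral: "p_integral p (euler_number n)"
proof (induction n rule: less_induct)
  case (less n)
  show ?case
  proof (cases "n = 0")
    case True
    have "euler_number 0 = 1"
      using fps_nth_sech_mult[of 0 1] by (simp add: sech_mult)
    thus ?thesis
      using True prime by simp
  next
    case False
    let ?S = "\<Sum>i<n. of_nat (n choose i) * euler_number i * (1 + (- 1) ^ (n - i))"
    have "2 * euler_number n = - ?S"
      using euler_number_recurrence[of n] False by (simp flip: lessThan_Suc_atMost)
    hence "euler_number n = - (1 / 2) * ?S"
      by simp
    moreover have "p_integral p (- (1 / 2) * ?S)"
      using less prime p_integral_half_powers(1)
      by (intro p_integral_mult[OF prime] p_integral_uminus[OF prime] p_integral_sum[OF prime]) auto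
    ultimately show ?thesis
      by simp
  qed
qed

lemma reciprocal_square_cong:
  assumes "0 < j" "j < p"
  shows "p_cong p (1 / of_nat (p - j) ^ 2) (1 / of_nat j ^ 2)"
proof (rule p_congI[OF prime])
  \<comment> \<open>The quotient comes from \<open>j^2 - (p-j)^2 = p(2j-p)\<close>.\<close>
  have "p_integral p ((2 * of_nat j - of_nat p) / of_nat j / of_nat j / of_nat (p - j) / of_nat (p - j))"
    using assms prime by (intro p_integral_divide_nat[OF prime]) auto
  thus "p_integral p ((2 * of_nat j - of_nat p) / (of_nat j ^ 2 * of_nat (p - j) ^ 2))"
    by (simp add: power2_eq_square mult.assoc)
  have "of_nat p = (of_nat (p - j) + of_nat j :: rat)" "of_nat (p - j) \<noteq> (0 :: rat)" "of_nat j \<noteq> (0 :: rat)"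
    using assms by (simp_all add: of_nat_diff)
  thus "1 / of_nat (p - j) ^ 2 = 1 / of_nat j ^ 2 + of_nat p * ((2 * of_nat j - of_nat p) / (of_nat j ^ 2 * of_nat (p - j) ^ 2) :: rat)"
    by (simp add: power2_eq_square divide_simps) (simp add: algebra_simps)
qed

text \<open>The sum \<open>T\<close> over \<open>1..p-1\<close> is evaluated twice. Reflection
  \<open>j\<close> to \<open>p-j\<close> gives \<open>T = 2H\<close>; splitting into even numbers
  \<open>2j\<close> and odd numbers \<open>p-2j\<close> gives \<open>T = H/2\<close>, both modulo
  \<open>p\<close>. Hence \<open>3H/2\<close> vanishes, and 3 is invertible as
  \<open>p > 3\<close>.\<close>

lemma harmonic_square_cong_0: "p_cong p (\<Sum>j = 1..N. 1 / of_nat j ^ 2) 0"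
proof -
  define f :: "nat \<Rightarrow> rat" where "f j = 1 / of_nat j ^ 2" for j
  define H where "H = (\<Sum>j = 1..N. f j)"
  define T where "T = (\<Sum>j = 1..2 * N. f j)"
  have "{1..2 * N} = {1..N} \<union> (\<lambda>j. p - j) ` {1..N}"
  proof (intro equalityI subsetI)
    fix x assume x: "x \<in> {1..2 * N}"
    show "x \<in> {1..N} \<union> (\<lambda>j. p - j) ` {1..N}"
    proof (cases "x \<le> N")
      case False
      hence "p - x \<in> {1..N}" "x = p - (p - x)"
        using x p by auto
      thus ?thesis by blast
    qed (use x in auto)
  qed (use p in auto)
  hence "T = H + (\<Sum>j\<in>(\<lambda>j. p - j) ` {1..N}. f j)"
    unfolding T_def H_def using p by (simp only:) (intro sum.union_disjoint, auto)
  also have "(\<Sum>j\<in>(\<lambda>j. p - j) ` {1..N}. f j) = (\<Sum>j = 1..N. f (p - j))"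
    using p by (subst sum.reindex) (auto intro!: inj_onI)
  finally have T: "T = H + (\<Sum>j = 1..N. f (p - j))" .
  have "p_cong p T (H + H)"
    unfolding T unfolding H_def f_def
    by (intro p_cong_add[OF prime] p_cong_sum[OF prime] p_cong_refl[OF prime] reciprocal_square_cong) (use p in auto)
  moreover have "p_cong p T (1 / 4 * H + 1 / 4 * H)"
  proof -
    have "(\<Sum>j = 1..2 * m. f j) = (\<Sum>j = 1..m. f (2 * j)) + (\<Sum>j = 1..m. f (2 * j - 1))" for m
      by (induction m) simp_all
    hence "T = (\<Sum>j = 1..N. f (2 * j)) + (\<Sum>j = 1..N. f (2 * j - 1))"
      by (simp add: T_def)
    also have "(\<Sum>j = 1..N. f (2 * j - 1)) = (\<Sum>j = 1..N. f (p - 2 * j))"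
      by (rule sum.reindex_bij_witness[of _ "\<lambda>j. N + 1 - j" "\<lambda>j. N + 1 - j"]) (auto simp: p intro!: arg_cong[of _ _ f])
    finally have T': "T = (\<Sum>j = 1..N. f (2 * j)) + (\<Sum>j = 1..N. f (p - 2 * j))" .
    have "p_cong p T ((\<Sum>j = 1..N. f (2 * j)) + (\<Sum>j = 1..N. f (2 * j)))"
      unfolding T' f_def
      by (intro p_cong_add[OF prime] p_cong_sum[OF prime] p_cong_refl[OF prime] reciprocal_square_cong) (use p in auto)
    also have "(\<Sum>j = 1..N. f (2 * j)) = 1 / 4 * H"
      by (simp add: H_def f_def sum_distrib_left power_mult_distrib)
    finally show ?thesis .
  qed
  ultimately have "p_cong p (H + H) (1 / 4 * H + 1 / 4 * H)"
    using p_cong_trans[OF prime] p_cong_sym[OF prime] by blast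
  then obtain z where z: "p_integral p z" "H + H = 1 / 4 * H + 1 / 4 * H + of_nat p * z"
    using p_congE[OF prime] by blast
  have "p_integral p (2 * z / of_nat 3)"
    using z gt3 prime by (intro p_integral_divide_nat[OF prime] p_integral_mult[OF prime]) auto
  thus ?thesis
    using z(2) unfolding H_def[symmetric] f_def[symmetric]
    by (intro p_congI[OF prime, of "2 * z / of_nat 3"]) auto
qed

text \<open>The power sum \<open>K\<close> links both sides. \<open>euler_number_sum\<close> with
  \<open>2N+1 = p\<close> reduces it to the Euler number, while Fermat's theorem replaces
  \<open>(2j)^(p-3)\<close> by \<open>1/(2j)^2\<close>, so that \<open>8K\<close> becomes
  \<open>h - 2H\<close> with \<open>H\<close> divisible by \<open>p\<close>.\<close>

lemma euler_number_cong:
  "p_cong p (\<Sum>i = 1..N div 2. 1 / of_nat i ^ 2) (4 * (-1) ^ N * euler_number (p - 3))"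
proof -
  define n where "n = p - 3"
  define s :: rat where "s = (-1) ^ N"
  define K :: rat where "K = (\<Sum>j = 1..N. (-1) ^ j * (2 * of_nat j) ^ n)"
  define h :: rat where "h = (\<Sum>i = 1..N div 2. 1 / of_nat i ^ 2)"
  define H :: rat where "H = (\<Sum>j = 1..N. 1 / of_nat j ^ 2)"
  have n: "n > 0" "even n" "n + 2 = p - 1"
    using gt3 p by (auto simp: n_def)
  have s: "s * s = 1"
    by (simp add: s_def flip: power_add mult_2)
  have ints: "p_integral p s" "p_integral p (1 / 2)" "p_integral p (1 / 4)"
    using p_integral_half_powers prime by (simp_all add: s_def)
  have "4 * s * K = (\<Sum>i\<le>n. of_nat (n choose i) * euler_number i * (of_nat p ^ (n - i) + (- of_nat p) ^ (n - i)))"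
  proof -
    have "of_nat p = (2 * of_nat N + 1 :: rat)"
      by (simp add: p)
    thus ?thesis
      using euler_number_sum[OF n(1,2), of N] by (simp only: s_def K_def)
  qed
  also have "\<dots> = 2 * euler_number n + of_nat p * (\<Sum>i<n. of_nat (n choose i) * euler_number i * (of_nat p ^ (n - i - 1) - (- of_nat p) ^ (n - i - 1)))"
    unfolding lessThan_Suc_atMost[symmetric] sum.lessThan_Suc sum_distrib_left
  proof -
    \<comment> \<open>Every term with \<open>i < n\<close> has a positive power of \<open>p\<close>;
      only \<open>i = n\<close> survives modulo \<open>p\<close>.\<close>
    have "of_nat p ^ k + (- of_nat p) ^ k = of_nat p * (of_nat p ^ (k - 1) - (- of_nat p) ^ (k - 1) :: rat)" if "k > 0" for k
      using that by (cases k) (simp_all add: algebra_simps)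
    hence "(\<Sum>i<n. of_nat (n choose i) * euler_number i * (of_nat p ^ (n - i) + (- of_nat p) ^ (n - i))) =
       (\<Sum>i<n. of_nat p * (of_nat (n choose i) * euler_number i * (of_nat p ^ (n - i - 1) - (- of_nat p) ^ (n - i - 1))))"
      by (intro sum.cong refl) simp
    thus "(\<Sum>i<n. of_nat (n choose i) * euler_number i * (of_nat p ^ (n - i) + (- of_nat p) ^ (n - i)))
        + of_nat (n choose n) * euler_number n * (of_nat p ^ (n - n) + (- of_nat p) ^ (n - n)) = 2 * euler_number n +
       (\<Sum>i<n. of_nat p * (of_nat (n choose i) * euler_number i * (of_nat p ^ (n - i - 1) - (- of_nat p) ^ (n - i - 1))))"
      by simp
  qed
  finally have "p_cong p (4 * s * K) (2 * euler_number n)"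
    using prime euler_number_p_integral by (intro p_congI[OF prime]) auto
  moreover have "p_integral p (2 * s)"
    using ints(1) prime by simp
  \<comment> \<open>Multiplying by \<open>2 * s\<close> moves the sign to the right-hand side,
    because \<open>s * s = 1\<close>.\<close>
  ultimately have "p_cong p (2 * s * (4 * s * K)) (2 * s * (2 * euler_number n))"
    by (rule p_cong_mult_left[OF prime])
  moreover have "2 * s * (4 * s * K) = s * s * (8 * K)" "2 * s * (2 * euler_number n) = 4 * s * euler_number n"
    by simp_all
  ultimately have K: "p_cong p (8 * K) (4 * s * euler_number n)"
    by (simp only: s mult_1_left)
  have summand: "p_cong p ((2 * of_nat j) ^ n) (1 / (2 * of_nat j) ^ 2)" if "j \<in> {1..N}" for j
  proof -
    have j: "0 < 2 * j" "2 * j < p"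
      using that p by auto
    have "\<not> p dvd 2 * j"
      using j by (simp add: nat_dvd_not_less)
    hence "[(2 * j) ^ (p - 1) = 1] (mod p)"
      using fermat_theorem[OF prime] by blast
    hence "int p dvd int ((2 * j) ^ (p - 1)) - 1"
      by (metis cong_iff_dvd_diff cong_int_iff of_nat_1)
    then obtain c where c: "int ((2 * j) ^ (p - 1)) - 1 = int p * c"
      by blast
    have "of_int (int ((2 * j) ^ (p - 1)) - 1) = (of_int (int p * c) :: rat)"
      by (simp only: c)
    hence c': "(2 * of_nat j) ^ (n + 2) = 1 + of_nat p * (of_int c :: rat)"
      unfolding n(3) by (simp add: algebra_simps)
    have "p_integral p (of_int c / of_nat (2 * j) / of_nat (2 * j))"
      using j prime by (intro p_integral_divide_nat[OF prime]) auto
    moreover have "(2 * of_nat j) ^ n = 1 / (2 * of_nat j) ^ 2 + of_nat p * (of_int c / of_nat (2 * j) / of_nat (2 * j) :: rat)"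
      using c' j by (simp add: power_add power2_eq_square field_simps)
    ultimately show ?thesis
      by (rule p_congI[OF prime])
  qed
  have "p_cong p K (\<Sum>j = 1..N. (-1) ^ j * (1 / (2 * of_nat j) ^ 2))"
    unfolding K_def using prime by (intro p_cong_sum[OF prime] p_cong_mult_left[OF prime] summand) auto
  also have "(\<Sum>j = 1..N. (-1) ^ j * (1 / (2 * of_nat j) ^ 2)) = 1 / 8 * h - 1 / 4 * H"
    unfolding alternating_sum_eq by (simp add: h_def H_def sum_distrib_left power_mult_distrib)
  finally have "p_cong p (8 * K) (8 * (1 / 8 * h - 1 / 4 * H))"
    by (rule p_cong_mult_left[OF prime]) (simp add: prime)
  hence "p_cong p (8 * K) (h + - 2 * H)"
    by (simp add: algebra_simps)
  moreover have "p_cong p (h + - 2 * H) (h + - 2 * 0)"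
    unfolding H_def using prime by (intro p_cong_add[OF prime] p_cong_mult_left[OF prime] harmonic_square_cong_0) auto
  ultimately have "p_cong p (8 * K) h"
    using p_cong_trans[OF prime] by fastforce
  from p_cong_trans[OF prime p_cong_sym[OF prime this] K] show ?thesis
    by (simp add: h_def s_def n_def)
qed

end

theorem theorem1p2:
  fixes p :: nat
  assumes "prime p" and "p > 3"
  shows "rat_cong p 4
           (\<Sum>k = 0..(p - 1) div 2. of_nat (3 * k + 1) / 16 ^ k * of_nat ((2 * k) choose k) ^ 3)
           (of_nat p + 2 * of_int (Legendre (-1) (int p)) * of_nat p ^ 3 * euler_number (p - 3))"
proof -
  note prime = assms(1)
  have "odd p"
    using assms by (simp add: prime_odd_nat)
  then obtain N where p: "p = 2 * N + 1"
    by (elim oddE)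
  note int_rules = p_integral_mult[OF prime] p_integral_add[OF prime] p_integral_diff[OF prime] p_integral_power[OF prime]
  define q :: rat where "q = of_nat p"
  define R where "R = shifted_fact N (- (1 / 2) * q)"
  define t where "t i = shifted_fact (N - 2 * i) q * shifted_fact (i - 1) (- q) / (of_nat i * (2 * of_nat i - q))" for i
  define Y where "Y = (\<Sum>i = 1..N div 2. t i)"
  define h :: rat where "h = (\<Sum>i = 1..N div 2. 1 / of_nat i ^ 2)"
  define E where "E = (-1) ^ N * euler_number (p - 3)"
  let ?S = "\<Sum>k = 0..(p - 1) div 2. of_nat (3 * k + 1) / 16 ^ k * of_nat ((2 * k) choose k) ^ 3 :: rat"
  have half: "p_integral p (1 / 2)" "p_integral p (1 / 4)" "p_integral p (- (1 / 2))"
    using p_integral_half_powers[OF prime p assms(2)] prime p_integral_uminus by auto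
  have half_p: "(p - 1) div 2 = N"
    by (simp add: p)
  have S: "?S = q * R ^ 2 * (shifted_fact N q + q ^ 2 * Y)"
    using sum_eq_shifted_facts[OF p] half_p by (simp add: add.commute q_def R_def Y_def t_def atLeast0AtMost)
  obtain z where z: "p_integral p z" "R ^ 2 * shifted_fact N q = 1 - 3 / 4 * q ^ 2 * (\<Sum>j = 1..N. 1 / of_nat j ^ 2) + q ^ 3 * z"
    using shifted_fact_prod_expansion[OF prime, of N] half p by (auto simp: R_def q_def)
  \<comment> \<open>Divisibility of the harmonic sum by \<open>p\<close> raises the
    \<open>p^2\<close> term of the expansion to order \<open>p^3\<close>, hence to
    \<open>p^4\<close> after the outer factor \<open>q\<close>.\<close>
  obtain w where w: "p_integral p w" "(\<Sum>j = 1..N. 1 / of_nat j ^ 2) = q * w"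
    using p_congE[OF prime harmonic_square_cong_0[OF prime p assms(2)]] by (auto simp: q_def)
  have R: "p_integral p R" "p_cong p R 1"
    using shifted_fact_cong[OF prime half(3), of N] p by (auto simp: R_def q_def)
  \<comment> \<open>Modulo \<open>p\<close> both shifted factorials are 1 and \<open>2i - p\<close>
    is \<open>2i\<close>.\<close>
  have t: "p_cong p (t i) (1 / 2 * (1 / of_nat i ^ 2))" if i: "i \<in> {1..N div 2}" for i
  proof -
    have i': "0 < i" "i < p" "0 < p - 2 * i" "p - 2 * i < p" "N - 2 * i < p" "i - 1 < p" "2 * i < p"
      using i p by auto
    have "p_integral p (1 / of_nat i / of_nat (p - 2 * i) * (1 / 2 / of_nat i))"
      using i' prime half by (intro int_rules p_integral_divide_nat[OF prime]) auto
    moreover have "of_nat (p - 2 * i) = (q - 2 * of_nat i)" "of_nat i \<noteq> (0 :: rat)" "q - 2 * of_nat i \<noteq> 0"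
      using i' by (auto simp: q_def of_nat_diff)
    ultimately have int: "p_integral p (- 1 / (2 * of_nat i ^ 2 * (q - 2 * of_nat i)))"
      and eq: "1 / (of_nat i * (2 * of_nat i - q)) = 1 / 2 * (1 / of_nat i ^ 2) + q * (- 1 / (2 * of_nat i ^ 2 * (q - 2 * of_nat i)))"
      using p_integral_uminus[OF prime, of "1 / of_nat i / of_nat (p - 2 * i) * (1 / 2 / of_nat i)"]
      by (simp_all add: power2_eq_square divide_simps) (simp_all add: algebra_simps)
    have inv: "p_cong p (1 / (of_nat i * (2 * of_nat i - q))) (1 / 2 * (1 / of_nat i ^ 2))"
      using p_congI[OF prime int] eq by (simp add: q_def)
    have "p_integral p (1 / 2 / of_nat i / of_nat i)"
      using i' half by (intro p_integral_divide_nat[OF prime]) auto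
    hence int2: "p_integral p (1 / 2 * (1 / of_nat i ^ 2))"
      by (simp add: power2_eq_square mult.assoc)
    have "p_cong p (shifted_fact (N - 2 * i) q * shifted_fact (i - 1) (- q) * (1 / (of_nat i * (2 * of_nat i - q))))
        (1 * 1 * (1 / 2 * (1 / of_nat i ^ 2)))"
      using shifted_fact_cong[OF prime, of 1 "N - 2 * i"] shifted_fact_cong[OF prime, of "- 1" "i - 1"] i' prime inv int2
      by (intro p_cong_mult[OF prime]) (auto simp: q_def)
    thus ?thesis
      by (simp add: t_def)
  qed
  have "p_cong p Y (1 / 2 * h)"
    unfolding Y_def h_def sum_distrib_left by (intro p_cong_sum[OF prime] t)
  moreover have "p_cong p (1 / 2 * h) (1 / 2 * (4 * (-1) ^ N * euler_number (p - 3)))"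
    unfolding h_def by (intro p_cong_mult_left[OF prime] euler_number_cong[OF prime p assms(2)] half)
  ultimately have Y: "p_cong p Y (2 * E)"
    using p_cong_trans[OF prime] by (fastforce simp: E_def)
  have "p_integral p E"
    unfolding E_def using prime euler_number_p_integral[OF prime p assms(2)] by (intro int_rules) auto
  \<comment> \<open>\<open>R ^ 2 * Y\<close> enters the sum with the factor \<open>q ^ 3\<close>, so
    its value modulo \<open>p\<close> suffices.\<close>
  hence "p_cong p (R ^ 2 * Y) (1 * (2 * E))"
    unfolding power2_eq_square using R Y prime p_cong_mult[OF prime R(2) R(2)]
    by (intro p_cong_mult[OF prime]) auto
  then obtain x where x: "p_integral p x" "R ^ 2 * Y = 2 * E + q * x"
    using p_congE[OF prime] by (auto simp: q_def)
  have "?S = q * (R ^ 2 * shifted_fact N q + q ^ 2 * (R ^ 2 * Y))"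
    unfolding S by (simp add: algebra_simps)
  also have "\<dots> = q + 2 * q ^ 3 * E + q ^ 4 * (z + x - 3 * (1 / 4) * w)"
    unfolding z(2) x(2) w(2) by (simp add: power2_eq_square power3_eq_cube power4_eq_xxxx algebra_simps)
  finally have diff: "?S - (q + 2 * q ^ 3 * E) = of_nat p ^ 4 * (z + x - 3 * (1 / 4) * w)"
    by (simp add: q_def)
  have rhs: "q + 2 * q ^ 3 * E = of_nat p + 2 * of_int (Legendre (-1) (int p)) * of_nat p ^ 3 * euler_number (p - 3)"
    by (simp add: q_def E_def Legendre_minus_one[OF prime p])
  have "p_integral p (z + x - 3 * (1 / 4) * w)"
    using z x w half prime by (intro int_rules) auto
  thus ?thesis
    using diff unfolding rhs by (rule rat_congI[OF prime])
qed

end
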